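(* Let $P=(G,R)$ be a partial field and let $0 \le r \le n$ be integers, $E=[n]$, $N=\binom{n}{r}-1$. For a point $p=(p_J)_{J \in \binom{E}{r}} \in \mathbf{P}^N(P)$ the following are equivalent: \begin{enumerate} \item There exists an $r \times n$ matrix $A$ with entries in $P$ such that (for a suitable choice of homogeneous coordinates of $p$) $p_J = \det(A_J)$ for all $J \in \binom{E}{r}$. \item $p$ satisfies the Plücker equations, i.e. $p$ is the Plücker vector of a strong $P$-matroid. \item $p$ is the Plücker vector of a weak $P$-matroid. \end{enumerate}
   Context: A partial field $P=(G,R)$ consists of a commutative ring $R$ with $1$ and a subgroup $G$ of the unit group of $R$ with $-1 \in G$; the elements of $P$ are the elements of $G \cup \{0\}$. $\mathbf{P}^N(P)$ denotes the set of nonzero vectors $(p_J)$ with all $p_J \in G\cup\{0\}$, modulo rescaling by elements of $G$; equations are interpreted in $R$. For an $r\times n$ matrix $A$ with columns indexed by $E$, $A_J$ is the $r \times r$ submatrix with column set $J$. $\binom{E}{r}$ is the set of $r$-subsets of $E$; set $X_J=0$ whenever $|J|<r$. For $S \in \binom{E}{r+1}$, $T \in \binom{E}{r-1}$, $x \in S$, let $\mathrm{sign}(x;S,T)=(-1)^m$, where $m$ is the number of $s \in S$ with $s>x$ plus the number of $t\in T$ with $t>x$. The Plücker equations are $\sum_{x\in S}\mathrm{sign}(x;S,T)X_{S\setminus\{x\}}X_{T\cup\{x\}}=0$ for all such $S,T$; the $3$-term Plücker equations are those with $|S\setminus T|=3$. A strong $P$-matroid of rank $r$ on $E$ is a point of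 $\mathbf{P}^N(P)$ satisfying the Plücker equations. A weak $P$-matroid of rank $r$ on $E$ is a point $p\in\mathbf{P}^N(P)$ satisfying the $3$-term Plücker equations such that $\{J : p_J \ne 0\}$ is the set of bases of a matroid of rank $r$ on $E$. *)

theory Defs
  imports "Jordan_Normal_Form.Determinant" "Jordan_Normal_Form.DL_Submatrix"
begin

text \<open>The ring \<open>R\<close> of a partial field \<open>P = (G, R)\<close> is an arbitrary type of class
  \<^class>\<open>comm_ring_1\<close>, so \<open>P\<close> is given by \<open>G\<close> alone. The class excludes the zero ring, over
  which there are no nonzero vectors and hence no points of projective space.\<close>

definition partial_field :: "'a::comm_ring_1 set \<Rightarrow> bool" where
  "partial_field G \<longleftrightarrow>
     1 \<in> G \<and> (\<forall>a\<in>G. \<forall>b\<in>G. a * b \<in> G) \<and> (\<forall>a\<in>G. \<exists>b\<in>G. a * b = 1) \<and> -1 \<in> G"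

definition pf_elements :: "'a::comm_ring_1 set \<Rightarrow> 'a set" where
  "pf_elements G = G \<union> {0}"

text \<open>The ground set is \<open>{0..<n}\<close>, matching the column indices of matrices.\<close>

definition rsubsets :: "nat \<Rightarrow> nat \<Rightarrow> nat set set" where
  "rsubsets r n = {J. J \<subseteq> {0..<n} \<and> card J = r}"

text \<open>A nonzero vector is a function on all sets that vanishes off the \<open>r\<close>-subsets of
  \<open>{0..<n}\<close>; this implements the convention \<open>X\<^sub>J = 0\<close> for \<open>|J| < r\<close>.\<close>

definition hvectors :: "'a::comm_ring_1 set \<Rightarrow> nat \<Rightarrow> nat \<Rightarrow> (nat set \<Rightarrow> 'a) set" where
  "hvectors G r n =
     {v. (\<forall>J\<in>rsubsets r n. v J \<in> pf_elements G) \<and>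
         (\<forall>J. J \<notin> rsubsets r n \<longrightarrow> v J = 0) \<and>
         (\<exists>J\<in>rsubsets r n. v J \<noteq> 0)}"

definition rescaling ::
  "'a::comm_ring_1 set \<Rightarrow> nat \<Rightarrow> nat \<Rightarrow> ((nat set \<Rightarrow> 'a) \<times> (nat set \<Rightarrow> 'a)) set" where
  "rescaling G r n =
     {(v, w). v \<in> hvectors G r n \<and> w \<in> hvectors G r n \<and> (\<exists>g\<in>G. w = (\<lambda>J. g * v J))}"

definition projective_space ::
  "'a::comm_ring_1 set \<Rightarrow> nat \<Rightarrow> nat \<Rightarrow> (nat set \<Rightarrow> 'a) set set" where
  "projective_space G r n = hvectors G r n // rescaling G r n"

definition plucker_sign :: "nat \<Rightarrow> nat set \<Rightarrow> nat set \<Rightarrow> 'a::comm_ring_1" where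
  "plucker_sign x S T = (-1) ^ (card {s\<in>S. s > x} + card {t\<in>T. t > x})"

definition plucker_relation ::
  "(nat set \<Rightarrow> 'a::comm_ring_1) \<Rightarrow> nat set \<Rightarrow> nat set \<Rightarrow> bool" where
  "plucker_relation v S T \<longleftrightarrow>
     (\<Sum>x\<in>S. plucker_sign x S T * v (S - {x}) * v (T \<union> {x})) = 0"

text \<open>The size of \<open>T\<close> is specified by \<open>card T + 1 = r\<close> because the truncated difference
  \<open>r - 1\<close> would admit \<open>T = {}\<close> for \<open>r = 0\<close>.\<close>

definition plucker_index :: "nat \<Rightarrow> nat \<Rightarrow> nat set \<Rightarrow> nat set \<Rightarrow> bool" where
  "plucker_index r n S T \<longleftrightarrow>
     S \<subseteq> {0..<n} \<and> card S = r + 1 \<and> T \<subseteq> {0..<n} \<and> card T + 1 = r"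

text \<open>The equations are homogeneous, so whether a point satisfies them does not depend on the
  representing vector; see \<open>plucker_relation_scale\<close>.\<close>

definition plucker_equations :: "nat \<Rightarrow> nat \<Rightarrow> (nat set \<Rightarrow> 'a::comm_ring_1) set \<Rightarrow> bool" where
  "plucker_equations r n p \<longleftrightarrow>
     (\<forall>v\<in>p. \<forall>S T. plucker_index r n S T \<longrightarrow> plucker_relation v S T)"

definition plucker_equations3 :: "nat \<Rightarrow> nat \<Rightarrow> (nat set \<Rightarrow> 'a::comm_ring_1) set \<Rightarrow> bool" where
  "plucker_equations3 r n p \<longleftrightarrow>
     (\<forall>v\<in>p. \<forall>S T. plucker_index r n S T \<and> card (S - T) = 3 \<longrightarrow> plucker_relation v S T)"

definition point_support :: "nat \<Rightarrow> nat \<Rightarrow> (nat set \<Rightarrow> 'a::comm_ring_1) set \<Rightarrow> nat set set" where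
  "point_support r n p = {J \<in> rsubsets r n. \<forall>v\<in>p. v J \<noteq> 0}"

definition matroid_bases :: "'e set \<Rightarrow> 'e set set \<Rightarrow> bool" where
  "matroid_bases E \<B> \<longleftrightarrow>
     finite E \<and> \<B> \<subseteq> Pow E \<and> \<B> \<noteq> {} \<and>
     (\<forall>A\<in>\<B>. \<forall>B\<in>\<B>. \<forall>a\<in>A - B. \<exists>b\<in>B - A. (A - {a}) \<union> {b} \<in> \<B>)"

definition matroid_bases_of_rank :: "nat \<Rightarrow> 'e set \<Rightarrow> 'e set set \<Rightarrow> bool" where
  "matroid_bases_of_rank r E \<B> \<longleftrightarrow> matroid_bases E \<B> \<and> (\<forall>B\<in>\<B>. card B = r)"

definition strong_matroid ::
  "'a::comm_ring_1 set \<Rightarrow> nat \<Rightarrow> nat \<Rightarrow> (nat set \<Rightarrow> 'a) set \<Rightarrow> bool" where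
  "strong_matroid G r n p \<longleftrightarrow> p \<in> projective_space G r n \<and> plucker_equations r n p"

definition weak_matroid ::
  "'a::comm_ring_1 set \<Rightarrow> nat \<Rightarrow> nat \<Rightarrow> (nat set \<Rightarrow> 'a) set \<Rightarrow> bool" where
  "weak_matroid G r n p \<longleftrightarrow>
     p \<in> projective_space G r n \<and> plucker_equations3 r n p \<and>
     matroid_bases_of_rank r {0..<n} (point_support r n p)"

definition representable ::
  "'a::comm_ring_1 set \<Rightarrow> nat \<Rightarrow> nat \<Rightarrow> (nat set \<Rightarrow> 'a) set \<Rightarrow> bool" where
  "representable G r n p \<longleftrightarrow>
     (\<exists>A\<in>carrier_mat r n. elements_mat A \<subseteq> pf_elements G \<and>
        (\<exists>v\<in>p. \<forall>J\<in>rsubsets r n. v J = det (submatrix A UNIV J)))"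

lemma mult_unit_eq_0_iff:
  assumes "partial_field G" "g \<in> G"
  shows "g * a = 0 \<longleftrightarrow> a = 0"
proof
  obtain h where h: "g * h = 1"
    using assms by (auto simp: partial_field_def)
  assume "g * a = 0"
  then have "h * (g * a) = 0" by simp
  with h show "a = 0" by (metis mult.assoc mult.commute mult_1)
qed simp

lemma equiv_rescaling:
  assumes pf: "partial_field G"
  shows "equiv (hvectors G r n) (rescaling G r n)"
proof (rule equivI)
  show "rescaling G r n \<subseteq> hvectors G r n \<times> hvectors G r n"
    by (auto simp: rescaling_def)
  show "refl_on (hvectors G r n) (rescaling G r n)"
    using pf by (auto simp: refl_on_def rescaling_def partial_field_def intro!: bexI[of _ 1])
  show "sym (rescaling G r n)"
  proof (rule symI)
    fix v w assume vw: "(v, w) \<in> rescaling G r n"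
    then obtain g where g: "g \<in> G" "w = (\<lambda>J. g * v J)" by (auto simp: rescaling_def)
    obtain h where h: "h \<in> G" "g * h = 1" using pf g(1) by (auto simp: partial_field_def)
    have "v = (\<lambda>J. h * w J)"
      using g(2) h(2) by (metis mult.assoc mult.commute mult_1)
    with vw h(1) show "(w, v) \<in> rescaling G r n" by (auto simp: rescaling_def)
  qed
  show "trans (rescaling G r n)"
  proof (rule transI)
    fix u v w assume "(u, v) \<in> rescaling G r n" "(v, w) \<in> rescaling G r n"
    moreover from this obtain g h where "g \<in> G" "h \<in> G" "w = (\<lambda>J. (h * g) * u J)"
      by (auto simp: rescaling_def mult.assoc)
    moreover from this have "h * g \<in> G" using pf by (auto simp: partial_field_def)
    ultimately show "(u, w) \<in> rescaling G r n" by (auto simp: rescaling_def)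
  qed
qed

lemma plucker_relation_scale:
  assumes "partial_field G" "g \<in> G"
  shows "plucker_relation (\<lambda>J. g * v J) S T \<longleftrightarrow> plucker_relation v S T"
proof -
  have "(\<Sum>x\<in>S. plucker_sign x S T * (g * v (S - {x})) * (g * v (T \<union> {x})))
      = g * (g * (\<Sum>x\<in>S. plucker_sign x S T * v (S - {x}) * v (T \<union> {x})))"
    by (simp add: sum_distrib_left mult_ac)
  with assms show ?thesis by (simp add: plucker_relation_def mult_unit_eq_0_iff)
qed

end

theory Submission
  imports Defs
begin

text \<open>Maximal minors satisfy the Plucker equations by two Laplace expansions. Basis exchange
  follows from the Plucker equations because a term that is a product of units forces a second
  nonzero term. For the converse from weak matroids, normalize \<open>p\<^sub>B = 1\<close> at a basis \<open>B\<close> and let \<open>A\<close> be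
  the fundamental matrix of \<open>p\<close> at \<open>B\<close>; its minors \<open>q\<close> agree with \<open>p\<close> at all \<open>J\<close> with
  \<open>|J - B| \<le> 1\<close>. Induct on \<open>|J - B|\<close>. If \<open>J - {a,b} \<union> {c,d}\<close> is a basis for some
  \<open>a, b \<in> J - B\<close> and \<open>c, d \<in> B - J\<close>, then one 3-term equation, valid for both \<open>p\<close> and \<open>q\<close>,
  determines the coordinate at \<open>J\<close> from coordinates closer to \<open>B\<close>. Otherwise basis exchange shows
  that neither \<open>J\<close> nor any \<open>J - {a} \<union> {c}\<close> is a basis, and the full Plucker equation for
  \<open>B \<union> {a}\<close> and \<open>J - {a}\<close> gives \<open>q\<^sub>J = 0 = p\<^sub>J\<close>.\<close>

section \<open>Ranks of elements in finite sets\<close>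

text \<open>\<open>pick\<close> is determined by ranks: deleting \<open>pick S j\<close> lowers the
  rank of exactly the larger elements by one. The skipped index matches the column shift in
  \<open>mat_delete\<close>.\<close>

lemma pick_Diff_pick:
  assumes "j < card S" "l < card S - 1"
  shows "pick (S - {pick S j}) l = pick S (if l < j then l else Suc l)"
proof -
  define m where "m = (if l < j then l else Suc l)"
  define y where "y = pick S m"
  have fin: "finite S" using assms(1) card.infinite by fastforce
  have m: "m < card S" "m \<noteq> j" using assms by (auto simp: m_def)
  have yS: "y \<in> S" using pick_in_set_le[OF m(1)] by (simp add: y_def)
  have jS: "pick S j \<in> S" using pick_in_set_le[OF assms(1)] .
  have less: "pick S j < y \<longleftrightarrow> j < m" and ne: "pick S j \<noteq> y"
    using pick_mono_le[OF m(1), of j] pick_mono_le[OF assms(1), of m] m(2)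
    by (auto simp: y_def nat_neq_iff)
  have cy: "card {a \<in> S. a < y} = m" using card_pick_le[OF m(1)] by (simp add: y_def)
  have "{a \<in> S - {pick S j}. a < y} = {a \<in> S. a < y} - {pick S j}" by blast
  moreover have "card ({a \<in> S. a < y} - {pick S j}) = (if j < m then m - 1 else m)"
    using fin jS less cy by (simp add: card_Diff_singleton_if)
  ultimately have "card {a \<in> S - {pick S j}. a < y} = l"
    by (auto simp: m_def split: if_splits)
  then show ?thesis
    using pick_card_in_set[of y "S - {pick S j}"] yS ne by (auto simp: m_def y_def)
qed

lemma bij_betw_pick:
  assumes "finite S"
  shows "bij_betw (pick S) {..<card S} S"
proof -
  have "inj_on (pick S) {..<card S}"
    by (rule inj_onI) (metis card_pick_le lessThan_iff)
  moreover have "pick S ` {..<card S} \<subseteq> S"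
    using pick_in_set_le by auto
  ultimately show ?thesis
    using assms by (simp add: bij_betw_def card_image card_subset_eq)
qed

lemma card_greater_pick:
  assumes "j < card S"
  shows "card {s \<in> S. s > pick S j} = card S - 1 - j"
proof -
  have fin: "finite S" using assms card.infinite by fastforce
  have "S = insert (pick S j) ({s \<in> S. s < pick S j} \<union> {s \<in> S. s > pick S j})"
    using pick_in_set_le[OF assms] by auto
  moreover have "card \<dots> = Suc (card {s \<in> S. s < pick S j} + card {s \<in> S. s > pick S j})"
    using fin by (subst card_insert_disjoint) (auto intro!: card_Un_disjoint)
  ultimately show ?thesis using card_pick_le[OF assms] by simp
qed

lemma neg_one_power_diff:
  assumes "j \<le> (k::nat)"
  shows "(-1 :: 'a::comm_ring_1) ^ (k - j) = (-1) ^ k * (-1) ^ j"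
  using assms by (auto simp: minus_one_power_iff)

section \<open>Maximal minors and their Plucker equations\<close>

text \<open>The cutoff supplies the convention of zero coordinates off the \<open>r\<close>-subsets,
  \<open>r\<close> being the number of rows; \<open>submatrix\<close> alone ignores indices beyond
  the last column.\<close>

definition maximal_minors :: "'a::comm_ring_1 mat \<Rightarrow> nat set \<Rightarrow> 'a" where
  "maximal_minors A J =
     (if J \<in> rsubsets (dim_row A) (dim_col A) then det (submatrix A UNIV J) else 0)"

lemma submatrix_UNIV_columns:
  assumes "A \<in> carrier_mat r n" "J \<subseteq> {0..<n}"
  shows "submatrix A UNIV J = mat r (card J) (\<lambda>(i, j). A $$ (i, pick J j))"
proof -
  have "{j. j < n \<and> j \<in> J} = J" using assms(2) by auto
  with assms show ?thesis by (auto simp: submatrix_def pick_UNIV)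
qed

lemma maximal_minors_eq_det:
  assumes "A \<in> carrier_mat r n" "J \<in> rsubsets r n"
  shows "maximal_minors A J = det (mat r r (\<lambda>(i, j). A $$ (i, pick J j)))"
  using assms by (auto simp: maximal_minors_def rsubsets_def submatrix_UNIV_columns)

text \<open>Laplace expansion of \<open>det A\<^sub>T\<^sub>x\<close> along the column \<open>x\<close>: the cofactors do not depend on \<open>x\<close>.\<close>

lemma maximal_minors_insert_linear:
  assumes A: "A \<in> carrier_mat r n" and T: "T \<subseteq> {0..<n}" "card T + 1 = r"
  obtains c where "\<And>x. x < n \<Longrightarrow>
    (\<Sum>i<r. A $$ (i, x) * c i) = (-1) ^ card {t \<in> T. t > x} * maximal_minors A (T \<union> {x})"
proof -
  have finT: "finite T" using T(1) finite_subset by blast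
  \<comment> \<open>Column \<open>x\<close> is put last instead of at its sorted place in
    \<open>T \<union> {x}\<close>, so that deleting it always leaves the columns of
    \<open>T\<close>.\<close>
  define M where "M x = mat r r (\<lambda>(i, j). A $$ (i, if j < r - 1 then pick T j else x))" for x
  have M: "M x \<in> carrier_mat r r" for x by (simp add: M_def)
  define c where "c i = cofactor (M 0) i (r - 1)" for i
  have del: "mat_delete (M x) i (r - 1) =
      mat (r - 1) (r - 1) (\<lambda>(k, j). A $$ (if k < i then k else Suc k, pick T j))"
    if "i < r" for x i
    using that by (auto simp: mat_delete_def M_def)
  have cof: "cofactor (M x) i (r - 1) = c i" if "i < r" for x i
    by (simp only: c_def cofactor_def del[OF that])
  have det_M: "det (M x) = (\<Sum>i<r. A $$ (i, x) * c i)" for x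
  proof -
    have "r - 1 < r" using T(2) by simp
    from laplace_expansion_column[OF M this]
    have "det (M x) = (\<Sum>i<r. M x $$ (i, r - 1) * cofactor (M x) i (r - 1))" .
    also have "\<dots> = (\<Sum>i<r. A $$ (i, x) * c i)"
    proof (rule sum.cong[OF refl])
      fix i assume i: "i \<in> {..<r}"
      have "M x $$ (i, r - 1) = A $$ (i, x)" using i by (simp add: M_def)
      then show "M x $$ (i, r - 1) * cofactor (M x) i (r - 1) = A $$ (i, x) * c i"
        using cof i by simp
    qed
    finally show ?thesis .
  qed
  have "det (M x) = (-1) ^ card {t \<in> T. t > x} * maximal_minors A (T \<union> {x})" if x: "x < n" for x
  proof (cases "x \<in> T")
    \<comment> \<open>Both sides vanish: \<open>M x\<close> repeats a column, and
      \<open>T \<union> {x}\<close> has only \<open>r - 1\<close> elements.\<close>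
    case True
    then obtain j where j: "j < card T" "x = pick T j"
      using bij_betw_pick[OF finT] by (auto simp: bij_betw_def)
    have "det (M x) = 0"
      using j T(2) by (intro det_identical_columns[OF M, of j "r - 1"]) (auto simp: M_def)
    moreover have "maximal_minors A (T \<union> {x}) = 0"
      using True A T(2) by (simp add: maximal_minors_def rsubsets_def insert_absorb)
    ultimately show ?thesis by simp
  next
    case False
    define U where "U = T \<union> {x}"
    have U: "U \<in> rsubsets r n" "card U = r" "finite U"
      using False T x finT by (auto simp: U_def rsubsets_def)
    define N where "N = mat r r (\<lambda>(i, j). A $$ (i, pick U j))"
    have N: "N \<in> carrier_mat r r" by (simp add: N_def)
    obtain p where p: "p < r" "pick U p = x"
      using bij_betw_pick[OF U(3)] U(2) by (force simp: bij_betw_def U_def)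
    have UT: "T = U - {pick U p}" using False p by (auto simp: U_def)
    have "card {s \<in> U. s > pick U p} = r - 1 - p"
      using card_greater_pick[of p U] p U by simp
    moreover have "{s \<in> U. s > pick U p} = {t \<in> T. t > x}" using p by (auto simp: U_def)
    ultimately have gt: "card {t \<in> T. t > x} = r - 1 - p" by simp
    \<comment> \<open>No columns are permuted: expanding \<open>N\<close> along column
      \<open>p\<close> and \<open>M x\<close> along its last column gives the same minors. The signs
      differ by \<open>(-1) ^ (r - 1 - p)\<close>, whose exponent counts the elements of
      \<open>T\<close> above \<open>x\<close>.\<close>
    have del': "mat_delete N i p = mat_delete (M x) i (r - 1)" if i: "i < r" for i
    proof (rule eq_matI)
      fix k l
      assume "k < dim_row (mat_delete (M x) i (r - 1))" "l < dim_col (mat_delete (M x) i (r - 1))"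
      then have kl: "k < r - 1" "l < r - 1" using M[of x] by auto
      have "pick T l = pick U (if l < p then l else Suc l)"
        unfolding UT using p U kl by (intro pick_Diff_pick) auto
      then show "mat_delete N i p $$ (k, l) = mat_delete (M x) i (r - 1) $$ (k, l)"
        unfolding del[OF i] using kl i by (auto simp: mat_delete_def N_def)
    qed (use M[of x] N in auto)
    have "(-1) ^ (r - 1 - p) * det N = (\<Sum>i<r. N $$ (i, p) * ((-1) ^ (r - 1 - p) * cofactor N i p))"
      by (simp add: laplace_expansion_column[OF N p(1)] sum_distrib_left mult_ac)
    also have "\<dots> = (\<Sum>i<r. A $$ (i, x) * c i)"
    proof (rule sum.cong[OF refl])
      fix i assume i: "i \<in> {..<r}"
      have "(-1) ^ (r - 1 - p) * (-1) ^ (i + p) = ((-1) ^ (i + (r - 1)) :: 'a)"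
        using p by (simp flip: power_add add: add.commute)
      then have "(-1) ^ (r - 1 - p) * cofactor N i p = c i"
        using i del' del by (simp add: cofactor_def c_def flip: mult.assoc)
      then show "N $$ (i, p) * ((-1) ^ (r - 1 - p) * cofactor N i p) = A $$ (i, x) * c i"
        using i p by (simp add: N_def)
    qed
    finally show ?thesis
      using maximal_minors_eq_det[OF A U(1)] gt by (simp add: det_M N_def U_def)
  qed
  with det_M show ?thesis by (intro that[of c]) simp
qed

text \<open>Laplace expansion of the singular matrix obtained from \<open>A\<^sub>S\<close> by repeating the row \<open>i\<close> on top.\<close>

lemma maximal_minors_row_dependence:
  assumes A: "A \<in> carrier_mat r n" and S: "S \<subseteq> {0..<n}" "card S = r + 1" and i: "i < r"
  shows "(\<Sum>x\<in>S. (-1) ^ card {s \<in> S. s > x} * maximal_minors A (S - {x}) * A $$ (i, x)) = 0"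
proof -
  have finS: "finite S" using S(1) finite_subset by blast
  define M where "M = mat (Suc r) (Suc r) (\<lambda>(k, j). A $$ (if k = 0 then i else k - 1, pick S j))"
  have M: "M \<in> carrier_mat (Suc r) (Suc r)" by (simp add: M_def)
  have "(\<Sum>x\<in>S. (-1) ^ card {s \<in> S. s > x} * maximal_minors A (S - {x}) * A $$ (i, x)) =
      (\<Sum>j<Suc r. (-1) ^ card {s \<in> S. s > pick S j} * maximal_minors A (S - {pick S j}) * A $$ (i, pick S j))"
    using sum.reindex_bij_betw[OF bij_betw_pick[OF finS], symmetric] S(2) by simp
  \<comment> \<open>The \<open>j\<close>-th element of \<open>S\<close> has \<open>r - j\<close>
    larger ones; the part \<open>j\<close> goes into the cofactor sign, and \<open>r\<close> factors
    out.\<close>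
  also have "\<dots> = (\<Sum>j<Suc r. (-1) ^ r * (M $$ (0, j) * cofactor M 0 j))"
  proof (rule sum.cong[OF refl])
    fix j assume "j \<in> {..<Suc r}"
    then have j: "j \<le> r" by simp
    have "mat_delete M 0 j = mat r r (\<lambda>(k, l). A $$ (k, pick (S - {pick S j}) l))"
    proof (rule eq_matI)
      fix k l
      assume "k < dim_row (mat r r (\<lambda>(k, l). A $$ (k, pick (S - {pick S j}) l)))"
        and "l < dim_col (mat r r (\<lambda>(k, l). A $$ (k, pick (S - {pick S j}) l)))"
      then have kl: "k < r" "l < r" by auto
      have "pick (S - {pick S j}) l = pick S (if l < j then l else Suc l)"
        using j S(2) kl by (intro pick_Diff_pick) auto
      then show "mat_delete M 0 j $$ (k, l) =
          mat r r (\<lambda>(k, l). A $$ (k, pick (S - {pick S j}) l)) $$ (k, l)"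
        using kl by (simp add: mat_delete_def M_def)
    qed (use M in auto)
    moreover have "S - {pick S j} \<in> rsubsets r n"
      using S j pick_in_set_le[of j S] by (auto simp: rsubsets_def card_Diff_singleton_if)
    ultimately have "maximal_minors A (S - {pick S j}) = det (mat_delete M 0 j)"
      using maximal_minors_eq_det[OF A] by simp
    moreover have "card {s \<in> S. s > pick S j} = r - j"
      using card_greater_pick[of j S] j S(2) by simp
    ultimately show "(-1) ^ card {s \<in> S. s > pick S j} * maximal_minors A (S - {pick S j}) * A $$ (i, pick S j)
        = (-1) ^ r * (M $$ (0, j) * cofactor M 0 j)"
      using j by (simp add: cofactor_def neg_one_power_diff M_def mult_ac)
  qed
  also have "\<dots> = (-1) ^ r * det M"
    by (simp add: laplace_expansion_row[OF M, of 0] sum_distrib_left del: sum.lessThan_Suc)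
  \<comment> \<open>The copy on top shifts row \<open>i\<close> of \<open>A\<close> to row
    \<open>Suc i\<close> of \<open>M\<close>.\<close>
  also have "det M = 0"
    using i by (intro det_identical_rows[OF M, of 0 "Suc i"]) (auto simp: M_def)
  finally show ?thesis by simp
qed

text \<open>Writing each signed minor at \<open>T \<union> {x}\<close> as a combination of the
  entries of column \<open>x\<close>, with coefficients independent of \<open>x\<close>, turns the
  relation into a combination of row dependences of \<open>A\<close> on \<open>S\<close>.\<close>

lemma plucker_relation_maximal_minors:
  assumes A: "A \<in> carrier_mat r n" and "plucker_index r n S T"
  shows "plucker_relation (maximal_minors A) S T"
proof -
  have S: "S \<subseteq> {0..<n}" "card S = r + 1" and T: "T \<subseteq> {0..<n}" "card T + 1 = r"
    using assms(2) by (auto simp: plucker_index_def)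
  obtain c where c: "\<And>x. x < n \<Longrightarrow>
    (\<Sum>i<r. A $$ (i, x) * c i) = (-1) ^ card {t \<in> T. t > x} * maximal_minors A (T \<union> {x})"
    using maximal_minors_insert_linear[OF A T] by blast
  let ?q = "\<lambda>x. (-1) ^ card {s \<in> S. s > x} * maximal_minors A (S - {x})"
  have "(\<Sum>x\<in>S. plucker_sign x S T * maximal_minors A (S - {x}) * maximal_minors A (T \<union> {x}))
      = (\<Sum>x\<in>S. ?q x * (\<Sum>i<r. A $$ (i, x) * c i))"
  proof (rule sum.cong[OF refl])
    fix x assume "x \<in> S"
    then have "x < n" using S(1) by auto
    show "plucker_sign x S T * maximal_minors A (S - {x}) * maximal_minors A (T \<union> {x})
      = ?q x * (\<Sum>i<r. A $$ (i, x) * c i)"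
      unfolding c[OF \<open>x < n\<close>] by (simp add: plucker_sign_def power_add mult_ac)
  qed
  also have "\<dots> = (\<Sum>i<r. c i * (\<Sum>x\<in>S. ?q x * A $$ (i, x)))"
    unfolding sum_distrib_left by (subst sum.swap) (simp add: mult_ac)
  also have "\<dots> = 0"
    using maximal_minors_row_dependence[OF A S] by simp
  finally show ?thesis by (simp add: plucker_relation_def)
qed

section \<open>Units, isolated terms and basis exchange\<close>

text \<open>The ring may have zero divisors, so only elements of \<open>G\<close> are
  cancelled.\<close>

lemma unit_mult_cancel:
  assumes "partial_field G" "g \<in> G" "g * a = g * b"
  shows "a = b"
proof -
  have "g * (a - b) = 0" using assms(3) by (simp add: algebra_simps)
  then show ?thesis using assms(1,2) by (simp add: mult_unit_eq_0_iff)
qed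

lemma plucker_sign_square: "plucker_sign x S T * (plucker_sign x S T * a) = a"
  by (simp add: plucker_sign_def flip: mult.assoc power_add)

text \<open>A relation determines one of its products from the others. This serves to compare two
  vectors and, with the zero vector as \<open>w\<close>, to show that a lone remaining product
  vanishes.\<close>

lemma plucker_relation_isolate:
  assumes "finite S" "x \<in> S" "plucker_relation v S T" "plucker_relation w S T"
    and "\<And>y. y \<in> S - {x} \<Longrightarrow> v (S - {y}) * v (T \<union> {y}) = w (S - {y}) * w (T \<union> {y})"
  shows "v (S - {x}) * v (T \<union> {x}) = w (S - {x}) * w (T \<union> {x})"
proof -
  let ?t = "\<lambda>u y. plucker_sign y S T * (u (S - {y}) * u (T \<union> {y}))"
  have "sum (?t v) S = sum (?t w) S"
    using assms(3,4) by (simp add: plucker_relation_def mult.assoc)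
  then have "?t v x + sum (?t v) (S - {x}) = ?t w x + sum (?t w) (S - {x})"
    unfolding sum.remove[OF assms(1,2)] .
  moreover have "sum (?t v) (S - {x}) = sum (?t w) (S - {x})"
    using assms(5) by (intro sum.cong) auto
  ultimately have "?t v x = ?t w x" by simp
  then show ?thesis by (metis plucker_sign_square)
qed

lemma hvectors_cases:
  assumes "v \<in> hvectors G r n"
  shows "v J = 0 \<or> v J \<in> G \<and> J \<in> rsubsets r n"
  using assms by (auto simp: hvectors_def pf_elements_def)

lemma matroid_support_if_plucker:
  assumes pf: "partial_field G" and v: "v \<in> hvectors G r n"
    and rel: "\<And>S T. plucker_index r n S T \<Longrightarrow> plucker_relation v S T"
  shows "matroid_bases_of_rank r {0..<n} {J \<in> rsubsets r n. v J \<noteq> 0}"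
proof -
  have "\<exists>b\<in>B - A. A - {a} \<union> {b} \<in> rsubsets r n \<and> v (A - {a} \<union> {b}) \<noteq> 0"
    if A: "A \<in> rsubsets r n" "v A \<noteq> 0" and B: "B \<in> rsubsets r n" "v B \<noteq> 0"
      and a: "a \<in> A - B" for A B a
  proof (rule ccontr)
    assume neg: "\<not> ?thesis"
    have fin: "finite A" "finite B"
      using A B finite_subset by (auto simp: rsubsets_def)
    \<comment> \<open>Up to sign, the term at \<open>a\<close> is \<open>v B * v A\<close>, and the
      others contain the candidate exchanges \<open>A - {a} \<union> {y}\<close> with
      \<open>y\<close> in \<open>B\<close>.\<close>
    define S T where "S = insert a B" and "T = A - {a}"
    have S: "finite S" "a \<in> S" using fin by (auto simp: S_def)
    have TA: "T \<union> {a} = A" "S - {a} = B" using a by (auto simp: S_def T_def)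
    have "card A > 0" using a fin by (auto simp: card_gt_0_iff)
    then have T: "card T + 1 = r" "T \<subseteq> {0..<n}"
      using a A fin by (auto simp: T_def rsubsets_def)
    then have idx: "plucker_index r n S T"
      using a A B fin by (auto simp: plucker_index_def S_def rsubsets_def)
    have "v (S - {y}) * v (T \<union> {y}) = 0" if y: "y \<in> S - {a}" for y
    proof (cases "y \<in> A")
      case True
      then have "T \<union> {y} = T" using y by (auto simp: T_def)
      then show ?thesis using hvectors_cases[OF v, of "T \<union> {y}"] T by (auto simp: rsubsets_def)
    next
      case False
      then have "y \<in> B - A" using y by (auto simp: S_def)
      then show ?thesis using neg hvectors_cases[OF v, of "T \<union> {y}"] by (auto simp: T_def)
    qed
    then have "v (S - {a}) * v (T \<union> {a}) = (\<lambda>_. 0) (S - {a}) * (\<lambda>_. 0) (T \<union> {a})"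
      by (intro plucker_relation_isolate[OF S rel[OF idx]]) (auto simp: plucker_relation_def)
    then have "v B * v A = 0" using TA by simp
    then show False
      using mult_unit_eq_0_iff[OF pf, of "v B" "v A"] hvectors_cases[OF v, of B] A B by auto
  qed
  then show ?thesis
    using v unfolding matroid_bases_of_rank_def matroid_bases_def
    by (auto simp: hvectors_def rsubsets_def)
qed

section \<open>Reconstruction of all coordinates from those near a basis\<close>

text \<open>The fundamental matrix of \<open>v\<close> with respect to \<open>B\<close>: its columns in \<open>B\<close> form the identity,
  which forces the entry \<open>(i, e)\<close> to be the signed coordinate at \<open>B\<close> with its \<open>i\<close>-th element
  exchanged for \<open>e\<close>.\<close>

lemma matrix_with_prescribed_near_minors:
  assumes pf: "partial_field G" and v: "v \<in> hvectors G r n" and B: "B \<in> rsubsets r n" "v B = 1"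
  obtains A where "A \<in> carrier_mat r n" "elements_mat A \<subseteq> pf_elements G"
    "\<And>J. J \<in> rsubsets r n \<Longrightarrow> card (J - B) \<le> 1 \<Longrightarrow> maximal_minors A J = v J"
proof -
  have finB: "finite B" and cB: "card B = r" and Bn: "B \<subseteq> {0..<n}"
    using B finite_subset by (auto simp: rsubsets_def)
  define T where "T i = B - {pick B i}" for i
  define s :: "nat \<Rightarrow> nat \<Rightarrow> 'a" where "s i e = (-1) ^ card {t \<in> T i. t > e}" for i e
  have ss: "s i e * (s i e * x) = x" for i e x
    by (simp add: s_def flip: mult.assoc power_add)
  \<comment> \<open>The sign \<open>s i e\<close> belongs to inserting \<open>e\<close> into
    \<open>T i\<close>; the factor \<open>s i (pick B i)\<close> makes the diagonal entries at the
    columns of \<open>B\<close> equal to 1.\<close>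
  define A where "A = mat r n (\<lambda>(i, e). s i e * (s i (pick B i) * v (T i \<union> {e})))"
  have A: "A \<in> carrier_mat r n" by (simp add: A_def)
  have pickB: "pick B i \<in> B" "pick B i < n" if "i < r" for i
    using pick_in_set_le[of i B] that cB Bn by auto
  have pick_inj: "pick B i = pick B j \<longleftrightarrow> i = j" if "i < r" "j < r" for i j
    using bij_betw_pick[OF finB] that cB by (auto simp: bij_betw_def inj_on_def)
  have T: "T i \<subseteq> {0..<n}" "card (T i) + 1 = r" "T i \<union> {pick B i} = B" if "i < r" for i
    using pickB[OF that] that cB Bn finB by (auto simp: T_def card_Diff_singleton_if)
  have not_r: "T i \<union> {e} \<notin> rsubsets r n" if "i < r" "e \<in> T i" for i e
    using T(2)[OF that(1)] that(2) by (simp add: rsubsets_def insert_absorb)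
  have AB: "A $$ (i, pick B j) = (if i = j then 1 else 0)" if ij: "i < r" "j < r" for i j
  proof (cases "i = j")
    case True
    then show ?thesis
      using ij pickB T(3)[OF ij(1)] B(2) ss[of i "pick B i" 1] by (simp add: A_def)
  next
    case False
    then have "pick B j \<in> T i" using ij pickB pick_inj by (auto simp: T_def)
    then have "v (T i \<union> {pick B j}) = 0" using hvectors_cases[OF v] not_r[OF ij(1)] by metis
    then show ?thesis using False ij pickB by (simp add: A_def)
  qed
  have "mat r r (\<lambda>(i, j). A $$ (i, pick B j)) = 1\<^sub>m r"
    by (rule eq_matI) (auto simp: AB)
  then have minB: "maximal_minors A B = 1" using maximal_minors_eq_det[OF A B(1)] by simp
  have "elements_mat A \<subseteq> pf_elements G"
  proof
    fix a assume "a \<in> elements_mat A"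
    then obtain i e where "a = s i e * (s i (pick B i) * v (T i \<union> {e}))"
      by (auto simp: A_def elements_mat_def)
    moreover have "s i e \<in> G" for i e
      using pf by (auto simp: s_def minus_one_power_iff partial_field_def)
    ultimately show "a \<in> pf_elements G"
      using hvectors_cases[OF v, of "T i \<union> {e}"] pf by (auto simp: pf_elements_def partial_field_def)
  qed
  moreover have "maximal_minors A J = v J" if J: "J \<in> rsubsets r n" "card (J - B) \<le> 1" for J
  proof (cases "J \<subseteq> B")
    case True
    then have "J = B" using J cB finB by (simp add: rsubsets_def card_subset_eq)
    then show ?thesis using minB B by simp
  next
    case False
    have finJ: "finite J" and cJ: "card J = r" and Jn: "J \<subseteq> {0..<n}"
      using J finite_subset by (auto simp: rsubsets_def)
    have "card (J - B) = 1" using J(2) False finJ by (simp add: le_Suc_eq)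
    moreover from this have "card (B - J) = 1"
      using card_le_sym_Diff[of B J] card_le_sym_Diff[of J B] finB finJ cB cJ by simp
    ultimately obtain e b where eb: "J - B = {e}" "B - J = {b}" by (metis card_1_singletonE)
    obtain i where i: "i < r" "b = pick B i"
      using eb bij_betw_pick[OF finB] cB by (force simp: bij_betw_def)
    have Je: "J = T i \<union> {e}" "e < n" using eb i Jn by (auto simp: T_def)
    \<comment> \<open>Evaluating the expansion at the columns of \<open>B\<close>, where
      \<open>A\<close> is the identity, reads off \<open>c\<close>: every \<open>c k\<close> except
      \<open>c i\<close> vanishes.\<close>
    obtain c where c: "\<And>x. x < n \<Longrightarrow>
      (\<Sum>k<r. A $$ (k, x) * c k) = s i x * maximal_minors A (T i \<union> {x})"
      using maximal_minors_insert_linear[OF A T(1,2)[OF i(1)]] unfolding s_def by blast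
    have ck: "c k = s i (pick B k) * maximal_minors A (T i \<union> {pick B k})" if "k < r" for k
    proof -
      have "(\<Sum>l<r. A $$ (l, pick B k) * c l) = (\<Sum>l<r. if l = k then c l else 0)"
        using that by (intro sum.cong) (auto simp: AB)
      then show ?thesis using c[OF pickB(2)[OF that]] that by simp
    qed
    have "c k = 0" if "k < r" "k \<noteq> i" for k
    proof -
      have "pick B k \<in> T i" using that i pickB pick_inj by (auto simp: T_def)
      then show ?thesis using ck[OF that(1)] not_r[OF i(1)] A by (simp add: maximal_minors_def)
    qed
    then have "(\<Sum>k<r. A $$ (k, e) * c k) = (\<Sum>k<r. if k = i then A $$ (k, e) * c k else 0)"
      by (intro sum.cong) auto
    then have "A $$ (i, e) * c i = s i e * maximal_minors A J"
      using c[OF Je(2)] Je(1) i by simp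
    moreover have "c i = s i (pick B i)" using ck[OF i(1)] T(3)[OF i(1)] minB by simp
    ultimately have "s i e * (s i (pick B i) * (s i (pick B i) * v J)) = s i e * maximal_minors A J"
      using i Je by (simp add: A_def mult_ac)
    then show ?thesis by (metis ss)
  qed
  ultimately show ?thesis using A that by blast
qed

text \<open>The hypotheses are asymmetric because \<open>v\<close> stands for the weak matroid and
  \<open>w\<close> for the minors: longer equations are applied to \<open>w\<close> alone, while the
  support of \<open>v\<close> controls their terms.\<close>

lemma plucker_vector_determined_near_basis:
  assumes pf: "partial_field G" and v: "v \<in> hvectors G r n"
    and matroid: "matroid_bases_of_rank r {0..<n} {J \<in> rsubsets r n. v J \<noteq> 0}"
    and rel3: "\<And>S T. plucker_index r n S T \<Longrightarrow> card (S - T) = 3 \<Longrightarrow> plucker_relation v S T"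
    and rel: "\<And>S T. plucker_index r n S T \<Longrightarrow> plucker_relation w S T"
    and w0: "\<And>J. J \<notin> rsubsets r n \<Longrightarrow> w J = 0"
    and B: "B \<in> rsubsets r n" "v B \<noteq> 0"
    and near: "\<And>J. J \<in> rsubsets r n \<Longrightarrow> card (J - B) \<le> 1 \<Longrightarrow> w J = v J"
  shows "w J = v J"
proof (induction "card (J - B)" arbitrary: J rule: less_induct)
  case less
  have v0: "v J = 0" if "J \<notin> rsubsets r n" for J using hvectors_cases[OF v] that by blast
  have exchange: "\<exists>b\<in>B - A. v (A - {a} \<union> {b}) \<noteq> 0" if "v A \<noteq> 0" "a \<in> A - B" for A a
  proof -
    let ?B = "{J \<in> rsubsets r n. v J \<noteq> 0}"
    have "A \<in> ?B" "B \<in> ?B" using v0 that B by auto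
    then have "\<exists>b\<in>B - A. A - {a} \<union> {b} \<in> ?B"
      using matroid that(2) unfolding matroid_bases_of_rank_def matroid_bases_def by meson
    then show ?thesis by blast
  qed
  have vG: "v B \<in> G" if "v B \<noteq> 0" for B using hvectors_cases[OF v] that by blast
  show ?case
  proof (cases "J \<in> rsubsets r n \<and> card (J - B) > 1")
    case False
    then show ?thesis using near[of J] w0[of J] v0[of J] by fastforce
  next
    case True
    then have Jn: "J \<subseteq> {0..<n}" and cJ: "card J = r" and gt: "card (J - B) > 1" and finJ: "finite J"
      using finite_subset by (auto simp: rsubsets_def)
    have Bn: "B \<subseteq> {0..<n}" and cB: "card B = r" and finB: "finite B"
      using B finite_subset by (auto simp: rsubsets_def)
    \<comment> \<open>Both vectors vanish off the \<open>r\<close>-subsets, so the claim covers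
      every set and the cardinality of \<open>K\<close> needs no check.\<close>
    have IH: "w K = v K" if "x \<in> J - B" "K - B \<subseteq> J - {x}" for K x
    proof -
      have "K - B \<subset> J - B" using that by blast
      then show ?thesis using less psubset_card_mono[of "J - B" "K - B"] finJ by simp
    qed
    have r: "r > 0" using gt finJ cJ by (cases r) auto
    have T_absorb: "w (J - {b} \<union> {y}) = 0" "v (J - {b} \<union> {y}) = 0" if "b \<in> J" "y \<in> J - {b}" for b y
    proof -
      have "J - {b} \<union> {y} = J - {b}" using that by auto
      moreover have "card (J - {b}) \<noteq> r" using card_Diff1_less[OF finJ that(1)] cJ by simp
      ultimately have "J - {b} \<union> {y} \<notin> rsubsets r n" by (simp add: rsubsets_def)
      then show "w (J - {b} \<union> {y}) = 0" "v (J - {b} \<union> {y}) = 0" using w0 v0 by blast+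
    qed
    show ?thesis
    proof (cases "\<exists>a\<in>J - B. \<exists>c\<in>B - J. v (J - {a} \<union> {c}) \<noteq> 0")
      case True
      then obtain a c where ac: "a \<in> J - B" "c \<in> B - J" "v (J - {a} \<union> {c}) \<noteq> 0" by blast
      define J' where "J' = J - {a} \<union> {c}"
      have "J - B \<noteq> {a}" using gt by auto
      then obtain b where b: "b \<in> J - B" "b \<noteq> a" using ac(1) by blast
      then have "b \<in> J' - B" by (auto simp: J'_def)
      then obtain d where d: "d \<in> B - J'" "v (J' - {b} \<union> {d}) \<noteq> 0"
        using exchange[of J' b] ac(3) by (auto simp: J'_def)
      \<comment> \<open>These sets give \<open>S - T = {b, c, d}\<close>. Up to sign, the term at
        \<open>b\<close> is the coordinate at \<open>J\<close> times that at
        \<open>J - {a, b} \<union> {c, d}\<close>, which is nonzero for \<open>v\<close>.\<close>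
      define S T where "S = J' \<union> {d}" and "T = J - {b}"
      have dJ: "d \<notin> J" "d \<noteq> c" using d ac by (auto simp: J'_def)
      have S_eq: "S = insert c (insert d (J - {a}))" by (auto simp: S_def J'_def)
      have S: "finite S" "b \<in> S" using finJ b by (auto simp: S_eq)
      have "card S = r + 1" using dJ ac finJ cJ r by (simp add: S_eq)
      moreover have "card T + 1 = r" using b finJ cJ r by (simp add: T_def)
      ultimately have idx: "plucker_index r n S T"
        using Jn Bn ac d by (auto simp: plucker_index_def S_eq T_def)
      have "S - T = {b, c, d}" using ac b d dJ by (auto simp: S_eq T_def)
      moreover have "b \<noteq> c" "b \<noteq> d" "c \<noteq> d" using ac b dJ by auto
      ultimately have rel_v: "plucker_relation v S T" using rel3[OF idx] by simp
      \<comment> \<open>Outside \<open>B\<close>, subsets of \<open>S\<close> contain only elements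
        of \<open>J - {a}\<close>, hence are closer to \<open>B\<close> than
        \<open>J\<close>.\<close>
      have nearS: "w (S - {y}) = v (S - {y})" for y
        using ac(2) d(1) by (intro IH[OF ac(1)]) (auto simp: S_eq)
      have "w (S - {y}) * w (T \<union> {y}) = v (S - {y}) * v (T \<union> {y})" if y: "y \<in> S - {b}" for y
      proof (cases "y \<in> J")
        case True
        then show ?thesis using T_absorb[of b y] b y by (simp add: T_def)
      next
        case False
        then have "y \<in> B" using y ac d by (auto simp: S_eq)
        then have "w (T \<union> {y}) = v (T \<union> {y})" using b by (intro IH[of b]) (auto simp: T_def)
        then show ?thesis using nearS by simp
      qed
      then have "w (S - {b}) * w (T \<union> {b}) = v (S - {b}) * v (T \<union> {b})"
        by (rule plucker_relation_isolate[OF S rel[OF idx] rel_v])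
      moreover have "T \<union> {b} = J" using b by (auto simp: T_def)
      moreover have "S - {b} = J' - {b} \<union> {d}" using b d by (auto simp: S_def)
      ultimately have "v (S - {b}) * w J = v (S - {b}) * v J" "v (S - {b}) \<noteq> 0"
        using nearS[of b] d(2) by metis+
      then show ?thesis using unit_mult_cancel[OF pf vG] by blast
    next
      case False
      obtain a where a: "a \<in> J - B" using gt by (metis card.empty ex_in_conv not_less_zero)
      \<comment> \<open>If \<open>J\<close> were a basis, exchanging \<open>a\<close> for an element
        of \<open>B\<close> would give a basis excluded by this case.\<close>
      have vJ: "v J = 0" using exchange[of J a] a False by blast
      \<comment> \<open>\<open>S - T\<close> has \<open>card (J - B) + 1\<close> elements, possibly
        more than 3, so this equation is used for \<open>w\<close> only.\<close>
      define S T where "S = insert a B" and "T = J - {a}"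
      have S: "finite S" "a \<in> S" using finB by (auto simp: S_def)
      have idx: "plucker_index r n S T"
        using a finB finJ cB cJ Bn Jn r by (auto simp: plucker_index_def S_def T_def)
      have "w (S - {y}) * w (T \<union> {y}) = 0" if y: "y \<in> S - {a}" for y
      proof (cases "y \<in> J")
        case True
        then show ?thesis using T_absorb[of a y] a y by (simp add: T_def)
      next
        case False
        then have yB: "y \<in> B - J" using y by (auto simp: S_def)
        then have "w (T \<union> {y}) = v (T \<union> {y})" using a by (intro IH[of a]) (auto simp: T_def)
        then show ?thesis
          using \<open>\<not> (\<exists>a\<in>J - B. \<exists>c\<in>B - J. v (J - {a} \<union> {c}) \<noteq> 0)\<close> a yB by (auto simp: T_def)
      qed
      then have "w (S - {a}) * w (T \<union> {a}) = (\<lambda>_. 0) (S - {a}) * (\<lambda>_. 0) (T \<union> {a})"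
        by (intro plucker_relation_isolate[OF S rel[OF idx]]) (auto simp: plucker_relation_def)
      moreover have "S - {a} = B" "T \<union> {a} = J" using a by (auto simp: S_def T_def)
      ultimately have "v B * w J = 0" using near[of B] B by simp
      then show ?thesis using mult_unit_eq_0_iff[OF pf vG[OF B(2)]] vJ by simp
    qed
  qed
qed

section \<open>Homogeneous coordinates and the equivalence\<close>

text \<open>Every nonzero coordinate lies in \<open>G\<close>, so dividing by one of them stays in
  the class.\<close>

lemma projective_point_normalized:
  assumes pf: "partial_field G" and p: "p \<in> projective_space G r n"
  obtains v B where "v \<in> hvectors G r n" "v \<in> p" "B \<in> rsubsets r n" "v B = 1"
    "\<And>w. w \<in> p \<Longrightarrow> \<exists>g\<in>G. w = (\<lambda>J. g * v J)"
proof -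
  have eq: "equiv (hvectors G r n) (rescaling G r n)" using equiv_rescaling[OF pf] .
  obtain u where u: "u \<in> hvectors G r n" "p = rescaling G r n `` {u}"
    using p by (auto simp: projective_space_def elim: quotientE)
  obtain B where B: "B \<in> rsubsets r n" "u B \<noteq> 0" using u by (auto simp: hvectors_def)
  then have "u B \<in> G" using hvectors_cases[OF u(1), of B] by simp
  then obtain g where g: "g \<in> G" "g * u B = 1"
    using pf by (auto simp: partial_field_def mult.commute)
  define v where "v = (\<lambda>J. g * u J)"
  have "v J = 0 \<or> v J \<in> G \<and> J \<in> rsubsets r n" for J
    using hvectors_cases[OF u(1), of J] g(1) pf by (auto simp: v_def partial_field_def)
  moreover have "v B \<noteq> 0" using g by (simp add: v_def)
  ultimately have "v \<in> hvectors G r n"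
    using B(1) by (force simp: hvectors_def pf_elements_def)
  moreover from this have "v \<in> p" using u g by (auto simp: rescaling_def v_def)
  moreover have "\<exists>g\<in>G. w = (\<lambda>J. g * v J)" if "w \<in> p" for w
  proof -
    have "(v, w) \<in> rescaling G r n"
      using \<open>v \<in> p\<close> that equivE[OF eq] unfolding u(2) by (meson Image_singleton_iff symD transD)
    then show ?thesis by (auto simp: rescaling_def)
  qed
  moreover have "v B = 1" using g by (simp add: v_def)
  ultimately show ?thesis using that B(1) by blast
qed

theorem theorem2p6:
  fixes G :: "'a::comm_ring_1 set" and r n :: nat and p :: "(nat set \<Rightarrow> 'a) set"
  assumes "partial_field G"
    and "r \<le> n"
    and "p \<in> projective_space G r n"
  shows "(representable G r n p \<longleftrightarrow> strong_matroid G r n p) \<and>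
         (strong_matroid G r n p \<longleftrightarrow> weak_matroid G r n p)"
proof -
  note pf = assms(1)
  obtain v B where v: "v \<in> hvectors G r n" "v \<in> p" and B: "B \<in> rsubsets r n" "v B = 1"
    and scale: "\<And>w. w \<in> p \<Longrightarrow> \<exists>g\<in>G. w = (\<lambda>J. g * v J)"
    using projective_point_normalized[OF pf assms(3)] by blast
  \<comment> \<open>Homogeneity reduces the equations and the support of \<open>p\<close> to the
    representative \<open>v\<close>.\<close>
  have rel_iff: "plucker_relation w S T \<longleftrightarrow> plucker_relation v S T" if "w \<in> p" for w S T
    using scale[OF that] plucker_relation_scale[OF pf] by blast
  have supp: "point_support r n p = {J \<in> rsubsets r n. v J \<noteq> 0}"
    using scale v(2) mult_unit_eq_0_iff[OF pf] unfolding point_support_def by fastforce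
  have "strong_matroid G r n p" if rep: "representable G r n p"
  proof -
    obtain A w where A: "A \<in> carrier_mat r n" and w: "w \<in> p"
      and det: "\<forall>J\<in>rsubsets r n. w J = det (submatrix A UNIV J)"
      using rep unfolding representable_def by blast
    \<comment> \<open>\<open>representable\<close> constrains \<open>w\<close> only on the
      \<open>r\<close>-subsets; elsewhere \<open>w\<close> and the minors are both zero.\<close>
    have "w J = 0" if "J \<notin> rsubsets r n" for J
      using scale[OF w] hvectors_cases[OF v(1), of J] that by auto
    then have "w = maximal_minors A"
      using det A by (auto simp: maximal_minors_def)
    then have "plucker_relation w S T" if "plucker_index r n S T" for S T
      using plucker_relation_maximal_minors[OF A that] by simp
    then show ?thesis
      using rel_iff w assms(3) by (auto simp: strong_matroid_def plucker_equations_def)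
  qed
  moreover have "weak_matroid G r n p" if "strong_matroid G r n p"
    using that matroid_support_if_plucker[OF pf v(1)] v(2) supp
    by (auto simp: strong_matroid_def weak_matroid_def plucker_equations_def plucker_equations3_def)
  moreover have "representable G r n p" if weak: "weak_matroid G r n p"
  proof -
    obtain A where A: "A \<in> carrier_mat r n" "elements_mat A \<subseteq> pf_elements G"
      and near: "\<And>J. J \<in> rsubsets r n \<Longrightarrow> card (J - B) \<le> 1 \<Longrightarrow> maximal_minors A J = v J"
      using matrix_with_prescribed_near_minors[OF pf v(1) B] by blast
    have minors: "maximal_minors A J = v J" for J
    proof (rule plucker_vector_determined_near_basis[OF pf v(1)])
      show "matroid_bases_of_rank r {0..<n} {J \<in> rsubsets r n. v J \<noteq> 0}"
        using weak supp by (simp add: weak_matroid_def)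
      show "plucker_relation v S T" if "plucker_index r n S T" "card (S - T) = 3" for S T
        using weak v(2) that by (auto simp: weak_matroid_def plucker_equations3_def)
      show "plucker_relation (maximal_minors A) S T" if "plucker_index r n S T" for S T
        using plucker_relation_maximal_minors[OF A(1) that] .
      show "maximal_minors A J = 0" if "J \<notin> rsubsets r n" for J
        using A(1) that by (simp add: maximal_minors_def)
      show "v B \<noteq> 0" using B(2) by simp
    qed (use B near in auto)
    have "\<forall>J\<in>rsubsets r n. v J = det (submatrix A UNIV J)"
      using A(1) unfolding minors[symmetric] by (auto simp: maximal_minors_def)
    then show ?thesis using A v(2) unfolding representable_def by blast
  qed
  ultimately show ?thesis by blast
qed

end
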